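(* Let $\xi$ be a random variable with values in $\mathbb{N}_0$, with $p_k=\mathbb{P}(\xi=k)$, $p_0=0$, mean $\mu=\mathbb{E}\,\xi$ and probability generating function $g(x)=\sum_{k\ge 0}p_kx^k$. Consider the Maker-Breaker game on the Galton-Watson tree with offspring distribution $\xi$ in the regime where the nodes carry no further information, let $p$ be the probability that Breaker wins when Breaker starts and $\bar p$ the probability that Breaker wins when Maker starts. Then $p$ is a solution to $$x^2=g(x).$$ It is equal to $0$ if $p_1=0$, to $1$ if $\mu\le 2$ and $p_1>0$, and to the unique solution in $(0,1)$ in all non-trivial cases ($\mu>2$ and $p_1>0$). Moreover $\bar p=g(p)=p^2$.
   Context: The Galton-Watson tree is the random rooted family tree with root $\mathbf{0}$ in which all individuals have independent numbers of children distributed as $\xi$. In the $(1,1)$ Maker-Breaker game the players move alternately; in each turn a player picks one available edge: Maker fixates it (securing it from deletion), Breaker removes it. Breaker wins if at some time the root lies in a finite component separated from the rest by removed edges; otherwise Maker wins. Internal nodes are those connected to the root by fixated edges (including the root); external nodes are children of internal nodes that are neither internal nor cut off. No-information regime ($I(v)=\emptyset$): the tree is explored during the game, and the players see only the internal and external nodes. In each turn a player plays an edge between an internal and an external node; all such edges are indistinguishable, so the choice is arbitrary. The number of available edges at Maker's successive turns is described by the embedded random walk $S_n=S_{n-1}+(\xi_n-2)$, $n\ge 1$, with $(\xi_n)_{n\ge1}$ i.i.d. copies of $\xi$ and $S_0=1$ if Breaker starts, $S_0=2$ if Maker starts. Maker wins iff $S_n>0$ for all $n\ge1$; that is, $p=\mathbb{P}(S_n\le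 0\text{ for some }n\ge1\mid S_0=1)$ and $\bar p=\mathbb{P}(S_n\le 0\text{ for some }n\ge1\mid S_0=2)$. *)

theory Defs
  imports "HOL-Probability.Probability"
begin

definition pgf :: "nat pmf \<Rightarrow> real \<Rightarrow> real" where
  "pgf xi x = (\<Sum>k. pmf xi k * x ^ k)"

text \<open>The mean is taken in the extended nonnegative reals, so that offspring laws of infinite mean
  are included.\<close>

definition pmf_mean :: "nat pmf \<Rightarrow> ennreal" where
  "pmf_mean xi = (\<integral>\<^sup>+ k. of_nat k \<partial>measure_pmf xi)"


text \<open>Individuals carry Ulam--Harris addresses: the root is \<open>[]\<close> and the children of \<open>v\<close> are
  \<open>v @ [i]\<close> for \<open>i < X v\<close>, where \<open>X v\<close> is the number of children of \<open>v\<close>.  An edge is represented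
  by its endpoint farther from the root.  The Galton--Watson tree is given by i.i.d. numbers \<open>N v\<close>
  attached to all addresses; only addresses reachable from the root belong to the tree.\<close>

type_synonym node = "nat list"

definition galton_watson :: "'w measure \<Rightarrow> nat pmf \<Rightarrow> (node \<Rightarrow> 'w \<Rightarrow> nat) \<Rightarrow> bool" where
  "galton_watson M xi N \<longleftrightarrow>
     prob_space M \<and>
     prob_space.indep_vars M (\<lambda>_. count_space UNIV) N UNIV \<and>
     (\<forall>v. distr M (count_space UNIV) (N v) = measure_pmf xi)"

inductive_set root_component :: "(node \<Rightarrow> nat) \<Rightarrow> node set \<Rightarrow> node set"
  for X :: "node \<Rightarrow> nat" and C :: "node set" where
  root: "[] \<in> root_component X C"
| child: "v \<in> root_component X C \<Longrightarrow> i < X v \<Longrightarrow> v @ [i] \<notin> C \<Longrightarrow> v @ [i] \<in> root_component X C"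


text \<open>The history of a game is the list of edges played so far; who played the \<open>n\<close>-th one
  (counting from \<open>0\<close>) is determined by the player \<open>st\<close> who starts.\<close>

datatype player = Maker | Breaker

definition turn :: "player \<Rightarrow> nat \<Rightarrow> player" where
  "turn st n = (if even n then st else (if st = Maker then Breaker else Maker))"

definition cut :: "player \<Rightarrow> node list \<Rightarrow> node set" where
  "cut st h = {h ! i | i. i < length h \<and> turn st i = Breaker}"

text \<open>All edges are played between an internal and an external node, so every edge fixated by Maker
  is connected to the root by fixated edges.\<close>

definition internal :: "player \<Rightarrow> node list \<Rightarrow> node set" where
  "internal st h = insert [] {h ! i | i. i < length h \<and> turn st i = Maker}"

definition external :: "(node \<Rightarrow> nat) \<Rightarrow> player \<Rightarrow> node list \<Rightarrow> node set" where
  "external X st h =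
     {v @ [i] | v i. v \<in> internal st h \<and> i < X v} - internal st h - cut st h"

text \<open>What the players see of the tree: the numbers of children of the internal nodes (hence the
  internal and the external nodes), but nothing about the offspring of external nodes.\<close>

definition visible :: "(node \<Rightarrow> nat) \<Rightarrow> player \<Rightarrow> node list \<Rightarrow> (node \<rightharpoonup> nat)" where
  "visible X st h = (\<lambda>v. if v \<in> internal st h then Some (X v) else None)"

text \<open>A strategy chooses the next edge on the basis of the history and of the visible part of the
  tree only.\<close>

type_synonym strategy = "node list \<Rightarrow> (node \<rightharpoonup> nat) \<Rightarrow> node"

definition legal_strategy :: "player \<Rightarrow> player \<Rightarrow> strategy \<Rightarrow> bool" where
  "legal_strategy st pl s \<longleftrightarrow>
     (\<forall>X h. turn st (length h) = pl \<longrightarrow> external X st h \<noteq> {} \<longrightarrow>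
        s h (visible X st h) \<in> external X st h)"

text \<open>The history after \<open>t\<close> turns; the game stops when there is no edge left to play.\<close>

primrec history ::
  "player \<Rightarrow> strategy \<Rightarrow> strategy \<Rightarrow> (node \<Rightarrow> nat) \<Rightarrow> nat \<Rightarrow> node list" where
  "history st mk br X 0 = []"
| "history st mk br X (Suc t) =
     (let h = history st mk br X t in
      if external X st h = {} then h
      else h @ [(if turn st (length h) = Maker then mk else br) h (visible X st h)])"

text \<open>If every individual has at least one child, a finite root component is automatically
  separated from the rest of the (infinite) tree by removed edges.\<close>

definition breaker_wins ::
  "player \<Rightarrow> strategy \<Rightarrow> strategy \<Rightarrow> (node \<Rightarrow> nat) \<Rightarrow> bool" where
  "breaker_wins st mk br X \<longleftrightarrow>
     (\<exists>t. finite (root_component X (cut st (history st mk br X t))))"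

definition breaker_win_prob ::
  "'w measure \<Rightarrow> (node \<Rightarrow> 'w \<Rightarrow> nat) \<Rightarrow> player \<Rightarrow> strategy \<Rightarrow> strategy \<Rightarrow> real" where
  "breaker_win_prob M N st mk br =
     measure M {\<omega> \<in> space M. breaker_wins st mk br (\<lambda>v. N v \<omega>)}"

end

theory Submission
  imports Defs
begin

text \<open>Consider the number of available edges just before Maker's turns.  Whatever the strategies,
  the node fixated by Maker has an offspring number that is independent of all that has been seen, so
  this number performs the random walk with steps \<open>\<xi> - 2\<close>, and Breaker wins iff the walk reaches
  \<open>0\<close>.  The walk goes down by at most one per step, so the probability of reaching \<open>0\<close> from \<open>k\<close> is
  \<open>s ^ k\<close>, where \<open>s\<close> is the smallest solution in \<open>[0, 1]\<close> of \<open>s = E s ^ (\<xi> - 1)\<close>; this is the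
  extinction probability of the branching process with offspring \<open>\<xi> - 1\<close>.  For \<open>x < 1\<close> the
  equation \<open>x = E x ^ (\<xi> - 1)\<close> means \<open>E (1 + x + ... + x ^ (\<xi> - 2)) = 1\<close>, and the left side
  increases with \<open>x\<close> to its limit \<open>\<mu> - 1\<close> at \<open>x = 1\<close>.\<close>

section \<open>Absorption of the walk\<close>

text \<open>\<open>absorption_prob xi n k\<close> is the probability that the walk with steps \<open>j - 2\<close>, \<open>j\<close> of law
  \<open>xi\<close>, started at \<open>k\<close>, reaches \<open>0\<close> within \<open>n\<close> steps.  The truncated subtraction only matters
  for \<open>k = 1\<close> and \<open>j = 0\<close>, where it keeps the walk at \<open>0\<close> instead of \<open>-1\<close>.\<close>

primrec absorption_prob :: "nat pmf \<Rightarrow> nat \<Rightarrow> nat \<Rightarrow> real" where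
  "absorption_prob xi 0 k = (if k = 0 then 1 else 0)"
| "absorption_prob xi (Suc n) k =
     (if k = 0 then 1
      else measure_pmf.expectation xi (\<lambda>j. absorption_prob xi n (k - 1 + j - 1)))"

section \<open>Expectations under a probability mass function\<close>

lemma integrable_pmf_bounded:
  fixes f :: "'a \<Rightarrow> real"
  assumes "\<And>x. x \<in> set_pmf xi \<Longrightarrow> \<bar>f x\<bar> \<le> B"
  shows "integrable (measure_pmf xi) f"
  by (rule measure_pmf.integrable_const_bound[where B = B])
    (use assms in \<open>auto simp: AE_measure_pmf_iff\<close>)

lemma expectation_pmf_mono:
  fixes f g :: "'a \<Rightarrow> real"
  assumes "integrable (measure_pmf xi) f" "integrable (measure_pmf xi) g"
    and "\<And>x. x \<in> set_pmf xi \<Longrightarrow> f x \<le> g x"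
  shows "measure_pmf.expectation xi f \<le> measure_pmf.expectation xi g"
  by (rule integral_mono_AE) (use assms in \<open>auto simp: AE_measure_pmf_iff\<close>)

text \<open>A nonnegative function of mean zero vanishes almost surely, which under a pmf means at
  every point of the support. This turns equalities of means into restrictions on the support of
  \<open>xi\<close>.\<close>

lemma expectation_pmf_eq_imp_eq:
  fixes f g :: "'a \<Rightarrow> real"
  assumes int: "integrable (measure_pmf xi) f" "integrable (measure_pmf xi) g"
    and le: "\<And>x. x \<in> set_pmf xi \<Longrightarrow> f x \<le> g x"
    and eq: "measure_pmf.expectation xi g \<le> measure_pmf.expectation xi f"
    and x: "x \<in> set_pmf xi"
  shows "f x = g x"
proof -
  have "measure_pmf.expectation xi (\<lambda>x. g x - f x) = 0"
    using int eq expectation_pmf_mono[OF int le] by simp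
  moreover have "AE x in measure_pmf xi. 0 \<le> g x - f x"
    using le by (simp add: AE_measure_pmf_iff)
  ultimately have "AE x in measure_pmf xi. g x - f x = 0"
    using int by (subst (asm) integral_nonneg_eq_0_iff_AE) auto
  with x show ?thesis by (auto simp: AE_measure_pmf_iff)
qed

lemma sums_expectation_nat_pmf:
  fixes f :: "nat \<Rightarrow> real"
  assumes "integrable (measure_pmf xi) f"
  shows "(\<lambda>j. pmf xi j * f j) sums measure_pmf.expectation xi f"
proof -
  have "integrable (count_space UNIV) (\<lambda>j. pmf xi j *\<^sub>R f j)"
    using assms by (subst (asm) measure_pmf_eq_density) (simp add: integrable_density)
  then have "(\<lambda>j. pmf xi j *\<^sub>R f j) sums (\<integral>j. pmf xi j *\<^sub>R f j \<partial>count_space UNIV)"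
    by (rule sums_integral_count_space_nat)
  also have "(\<integral>j. pmf xi j *\<^sub>R f j \<partial>count_space UNIV) = measure_pmf.expectation xi f"
    by (subst measure_pmf_eq_density) (simp add: integral_density)
  finally show ?thesis by simp
qed

lemma absorption_prob_0 [simp]: "absorption_prob xi n 0 = 1"
  by (cases n) auto

lemma absorption_prob_bounds: "0 \<le> absorption_prob xi n k \<and> absorption_prob xi n k \<le> 1"
proof (induction n arbitrary: k)
  case (Suc n)
  have "integrable (measure_pmf xi) (\<lambda>j. absorption_prob xi n (k - 1 + j - 1))"
    by (rule integrable_pmf_bounded[of _ _ 1]) (use Suc in auto)
  from expectation_pmf_mono[OF this, of "\<lambda>_. 1"] Suc show ?case
    by (auto intro!: integral_nonneg_AE)
qed simp

lemmas absorption_prob_nonneg = conjunct1[OF absorption_prob_bounds]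
  and absorption_prob_le_1 = conjunct2[OF absorption_prob_bounds]

lemma integrable_absorption_prob [simp]:
  "integrable (measure_pmf xi) (\<lambda>j. absorption_prob xi n (f j))"
  by (rule integrable_pmf_bounded[of _ _ 1])
    (simp add: absorption_prob_nonneg absorption_prob_le_1)

lemma absorption_prob_Suc_mono: "absorption_prob xi n k \<le> absorption_prob xi (Suc n) k"
proof (induction n arbitrary: k)
  case 0
  show ?case using absorption_prob_nonneg[of xi "Suc 0" k]
    by (cases "k = 0") (simp_all del: absorption_prob.simps(2))
next
  case (Suc n)
  show ?case
    by (subst (1 2) absorption_prob.simps(2))
      (auto intro!: expectation_pmf_mono Suc simp del: absorption_prob.simps(2))
qed

lemma incseq_absorption_prob: "incseq (\<lambda>n. absorption_prob xi n k)"
  by (rule incseq_SucI) (rule absorption_prob_Suc_mono)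

definition eventual_absorption_prob :: "nat pmf \<Rightarrow> nat \<Rightarrow> real" where
  "eventual_absorption_prob xi k = lim (\<lambda>n. absorption_prob xi n k)"

lemma LIMSEQ_absorption_prob:
  "(\<lambda>n. absorption_prob xi n k) \<longlonglongrightarrow> eventual_absorption_prob xi k"
proof -
  obtain L where "(\<lambda>n. absorption_prob xi n k) \<longlonglongrightarrow> L"
    by (rule incseq_convergent[OF incseq_absorption_prob, of xi k 1])
      (auto simp: absorption_prob_le_1)
  then show ?thesis by (simp add: eventual_absorption_prob_def limI)
qed

lemma eventual_absorption_prob_nonneg: "0 \<le> eventual_absorption_prob xi k"
  by (rule LIMSEQ_le_const[OF LIMSEQ_absorption_prob]) (simp add: absorption_prob_nonneg)

lemma eventual_absorption_prob_le_1: "eventual_absorption_prob xi k \<le> 1"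
  by (rule LIMSEQ_le_const2[OF LIMSEQ_absorption_prob]) (simp add: absorption_prob_le_1)

lemma eventual_absorption_prob_0 [simp]: "eventual_absorption_prob xi 0 = 1"
  by (simp add: eventual_absorption_prob_def)

lemma eventual_absorption_prob_step:
  assumes "k > 0"
  shows "eventual_absorption_prob xi k =
    measure_pmf.expectation xi (\<lambda>j. eventual_absorption_prob xi (k - 1 + j - 1))"
proof (rule LIMSEQ_unique)
  show "(\<lambda>n. absorption_prob xi (Suc n) k) \<longlonglongrightarrow> eventual_absorption_prob xi k"
    by (rule LIMSEQ_Suc) (rule LIMSEQ_absorption_prob)
  have "(\<lambda>n. measure_pmf.expectation xi (\<lambda>j. absorption_prob xi n (k - 1 + j - 1)))
    \<longlonglongrightarrow> measure_pmf.expectation xi (\<lambda>j. eventual_absorption_prob xi (k - 1 + j - 1))"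
    by (rule integral_dominated_convergence[where w = "\<lambda>_. 1"])
      (auto simp: absorption_prob_nonneg absorption_prob_le_1 intro!: LIMSEQ_absorption_prob)
  then show "(\<lambda>n. absorption_prob xi (Suc n) k)
    \<longlonglongrightarrow> measure_pmf.expectation xi (\<lambda>j. eventual_absorption_prob xi (k - 1 + j - 1))"
    using assms by simp
qed

text \<open>If \<open>pmf xi 0 = 0\<close>, this is the generating function of
  \<open>xi - 1\<close>. Passing to it from x^2 = g(x) divides out the root 0 that comes from the
  common factor x.\<close>

definition reduced_pgf :: "nat pmf \<Rightarrow> real \<Rightarrow> real" where
  "reduced_pgf xi x = measure_pmf.expectation xi (\<lambda>j. x ^ (j - 1))"

lemma integrable_pmf_power [simp]:
  fixes x :: real
  assumes "0 \<le> x" "x \<le> 1"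
  shows "integrable (measure_pmf xi) (\<lambda>j. x ^ f j)"
  by (rule integrable_pmf_bounded[of _ _ 1]) (use assms in \<open>auto simp: power_le_one\<close>)

lemma pgf_eq_expectation:
  assumes "0 \<le> x" "x \<le> 1"
  shows "pgf xi x = measure_pmf.expectation xi (\<lambda>j. x ^ j)"
  unfolding pgf_def by (rule sums_unique[symmetric], rule sums_expectation_nat_pmf) (use assms in simp)

lemma pgf_eq_reduced_pgf:
  assumes "pmf xi 0 = 0" "0 \<le> x" "x \<le> 1"
  shows "pgf xi x = x * reduced_pgf xi x"
proof -
  have "measure_pmf.expectation xi (\<lambda>j. x ^ j) = measure_pmf.expectation xi (\<lambda>j. x * x ^ (j - 1))"
  proof (rule integral_cong_AE; simp add: AE_measure_pmf_iff; intro ballI)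
    fix j assume "j \<in> set_pmf xi"
    then have "j \<noteq> 0" using assms(1) by (metis set_pmf_iff)
    then show "x ^ j = x * x ^ (j - Suc 0)" by (cases j) auto
  qed
  then show ?thesis
    using assms by (simp add: pgf_eq_expectation reduced_pgf_def)
qed

text \<open>Comparison with a supersolution: averaging over one step multiplies r^(k-1) by
  \<open>reduced_pgf xi r\<close>, which is at most r.\<close>

lemma absorption_prob_le_power:
  assumes "pmf xi 0 = 0" "0 \<le> r" "r \<le> 1" "reduced_pgf xi r \<le> r"
  shows "absorption_prob xi n k \<le> r ^ k"
proof (induction n arbitrary: k)
  case (Suc n)
  show ?case
  proof (cases k)
    case (Suc l)
    have "absorption_prob xi (Suc n) k = measure_pmf.expectation xi (\<lambda>j. absorption_prob xi n (l + j - 1))"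
      using Suc by simp
    also have "\<dots> \<le> measure_pmf.expectation xi (\<lambda>j. r ^ l * r ^ (j - 1))"
    proof (rule expectation_pmf_mono)
      fix j assume "j \<in> set_pmf xi"
      then have "j \<noteq> 0" using assms(1) by (metis set_pmf_iff)
      then have "l + j - 1 = l + (j - 1)" by simp
      then show "absorption_prob xi n (l + j - 1) \<le> r ^ l * r ^ (j - 1)"
        using Suc.IH[of "l + j - 1"] by (simp add: power_add)
    qed (use assms in auto)
    also have "\<dots> = r ^ l * reduced_pgf xi r" by (simp add: reduced_pgf_def)
    also have "\<dots> \<le> r ^ l * r" using assms by (intro mult_left_mono) auto
    finally show ?thesis using Suc by (simp add: mult.commute del: absorption_prob.simps)
  qed simp
qed (use assms in simp)

text \<open>One way for the walk to get from k + l to 0 is to descend by k within n steps and then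
  by l within m further steps. Since \<open>xi\<close> avoids 0, the truncated subtraction is exact
  and the first descent can be shifted up by l.\<close>

lemma absorption_prob_add:
  assumes "pmf xi 0 = 0"
  shows "absorption_prob xi n k * absorption_prob xi m l \<le> absorption_prob xi (n + m) (k + l)"
proof (induction n arbitrary: k)
  case 0
  show ?case using absorption_prob_nonneg by simp
next
  case (Suc n)
  show ?case
  proof (cases k)
    case 0
    have "absorption_prob xi m l \<le> absorption_prob xi (Suc n + m) l"
      using incseq_absorption_prob by (rule incseqD) simp
    then show ?thesis using 0 by (simp del: absorption_prob.simps)
  next
    case (Suc k')
    have "absorption_prob xi (Suc n) k * absorption_prob xi m l
      = measure_pmf.expectation xi (\<lambda>j. absorption_prob xi n (k' + j - 1) * absorption_prob xi m l)"
      using Suc by simp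
    also have "\<dots> \<le> measure_pmf.expectation xi (\<lambda>j. absorption_prob xi (n + m) (k' + l + j - 1))"
    proof (rule expectation_pmf_mono)
      fix j assume "j \<in> set_pmf xi"
      then have "j \<noteq> 0" using assms(1) by (metis set_pmf_iff)
      then have "k' + l + j - 1 = k' + j - 1 + l" by simp
      then show "absorption_prob xi n (k' + j - 1) * absorption_prob xi m l
          \<le> absorption_prob xi (n + m) (k' + l + j - 1)"
        using Suc.IH[of "k' + j - 1"] by simp
    qed auto
    also have "\<dots> = absorption_prob xi (Suc n + m) (k + l)" using Suc by simp
    finally show ?thesis .
  qed
qed

lemma eventual_absorption_prob_add:
  assumes "pmf xi 0 = 0"
  shows "eventual_absorption_prob xi k * eventual_absorption_prob xi l
    \<le> eventual_absorption_prob xi (k + l)"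
proof (rule LIMSEQ_le)
  show "(\<lambda>n. absorption_prob xi n k * absorption_prob xi n l)
      \<longlonglongrightarrow> eventual_absorption_prob xi k * eventual_absorption_prob xi l"
    by (intro tendsto_mult LIMSEQ_absorption_prob)
  show "(\<lambda>n. absorption_prob xi (n + n) (k + l)) \<longlonglongrightarrow> eventual_absorption_prob xi (k + l)"
    using LIMSEQ_subseq_LIMSEQ[OF LIMSEQ_absorption_prob, of "\<lambda>n. n + n"]
    by (simp add: strict_mono_def o_def)
qed (auto intro: absorption_prob_add[OF assms])

lemma eventual_absorption_prob_le_power:
  assumes "pmf xi 0 = 0" "0 \<le> r" "r \<le> 1" "reduced_pgf xi r \<le> r"
  shows "eventual_absorption_prob xi k \<le> r ^ k"
  by (rule LIMSEQ_le_const2[OF LIMSEQ_absorption_prob])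
    (use absorption_prob_le_power[OF assms] in auto)

text \<open>Supermultiplicativity bounds the absorption probability from \<open>k\<close> below by a power; it makes
  the base of that power a supersolution of the fixed-point equation, which gives the matching upper
  bound.\<close>

lemma
  assumes "pmf xi 0 = 0"
  shows eventual_absorption_prob_eq_power:
      "eventual_absorption_prob xi k = eventual_absorption_prob xi 1 ^ k"
    and reduced_pgf_eventual_absorption_prob:
      "reduced_pgf xi (eventual_absorption_prob xi 1) = eventual_absorption_prob xi 1"
proof -
  let ?s = "eventual_absorption_prob xi 1"
  have s: "0 \<le> ?s" "?s \<le> 1"
    by (rule eventual_absorption_prob_nonneg eventual_absorption_prob_le_1)+
  have lower: "?s ^ k \<le> eventual_absorption_prob xi k" for k
  proof (induction k)
    case (Suc k)
    have "?s * ?s ^ k \<le> ?s * eventual_absorption_prob xi k"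
      by (rule mult_left_mono[OF Suc s(1)])
    also have "\<dots> \<le> eventual_absorption_prob xi (1 + k)"
      by (rule eventual_absorption_prob_add[OF assms])
    finally show ?case by simp
  qed simp
  have step: "?s = measure_pmf.expectation xi (\<lambda>j. eventual_absorption_prob xi (j - 1))"
    using eventual_absorption_prob_step[of 1 xi] by simp
  have int: "integrable (measure_pmf xi) (\<lambda>j. eventual_absorption_prob xi (j - 1))"
    by (rule integrable_pmf_bounded[of _ _ 1])
      (simp add: eventual_absorption_prob_nonneg eventual_absorption_prob_le_1)
  have "reduced_pgf xi ?s \<le> ?s"
    unfolding reduced_pgf_def
    by (subst (2) step) (rule expectation_pmf_mono[OF _ int lower], use s in simp)
  from eventual_absorption_prob_le_power[OF assms s this]
  show eq: "eventual_absorption_prob xi k = ?s ^ k" for k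
    using lower[of k] by (simp add: antisym)
  show "reduced_pgf xi ?s = ?s"
    unfolding reduced_pgf_def eq[symmetric] by (rule step[symmetric])
qed

section \<open>Fixed points of \<open>reduced_pgf\<close> and the mean\<close>

lemma reduced_pgf_geometric_sum:
  assumes "0 \<le> x" "x < 1"
  shows "integrable (measure_pmf xi) (\<lambda>j. \<Sum>i<j - 1. x ^ i)"
    and "1 - reduced_pgf xi x = (1 - x) * measure_pmf.expectation xi (\<lambda>j. \<Sum>i<j - 1. x ^ i)"
proof -
  have eq: "(1 - x) * (\<Sum>i<m. x ^ i) = 1 - x ^ m" for m
    using one_diff_power_eq[of x m] by simp
  show int: "integrable (measure_pmf xi) (\<lambda>j. \<Sum>i<j - 1. x ^ i)"
  \<comment> \<open>The full geometric series bounds all partial sums, so the expectation is finite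
    even if \<open>xi\<close> has infinite mean.\<close>
  proof (rule integrable_pmf_bounded[of _ _ "1 / (1 - x)"])
    fix j
    have "(1 - x) * (\<Sum>i<j - 1. x ^ i) \<le> 1" using assms by (simp add: eq)
    then show "\<bar>\<Sum>i<j - 1. x ^ i\<bar> \<le> 1 / (1 - x)"
      using assms by (simp add: field_simps sum_nonneg)
  qed
  have "1 - reduced_pgf xi x = measure_pmf.expectation xi (\<lambda>j. 1 - x ^ (j - 1))"
    using assms by (simp add: reduced_pgf_def)
  also have "\<dots> = measure_pmf.expectation xi (\<lambda>j. (1 - x) * (\<Sum>i<j - 1. x ^ i))"
    by (simp only: eq)
  finally show "1 - reduced_pgf xi x = (1 - x) * measure_pmf.expectation xi (\<lambda>j. \<Sum>i<j - 1. x ^ i)"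
    by simp
qed

text \<open>Cancelling the factor 1 - x discards the fixed point 1 and leaves an equation whose left
  side is monotone in x.\<close>

lemma reduced_pgf_fixed_point_iff:
  assumes "0 \<le> x" "x < 1"
  shows "reduced_pgf xi x = x \<longleftrightarrow> measure_pmf.expectation xi (\<lambda>j. \<Sum>i<j - 1. x ^ i) = 1"
proof -
  have "reduced_pgf xi x = x \<longleftrightarrow> 1 - reduced_pgf xi x = (1 - x) * 1" by auto
  also have "\<dots> \<longleftrightarrow> measure_pmf.expectation xi (\<lambda>j. \<Sum>i<j - 1. x ^ i) = 1"
    unfolding reduced_pgf_geometric_sum(2)[OF assms] using assms by (subst mult_left_cancel) auto
  finally show ?thesis .
qed

text \<open>The exponent 1 gives strictness. With m = j - 1 this concerns offspring numbers j of at
  least 3.\<close>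

lemma geometric_sum_strict_mono:
  fixes x y :: real
  assumes "0 \<le> x" "x < y" "2 \<le> m"
  shows "(\<Sum>i<m. x ^ i) < (\<Sum>i<m. y ^ i)"
proof (rule sum_strict_mono_ex1)
  show "\<forall>i\<in>{..<m}. x ^ i \<le> y ^ i" using assms by (auto intro: power_mono)
  show "\<exists>i\<in>{..<m}. x ^ i < y ^ i" using assms by (intro bexI[of _ 1]) auto
qed simp

text \<open>At a fixed point x < 1 the geometric sums have mean 1, while they are bounded by j - 1,
  whose mean is at most 1. So they equal j - 1 on the support, which leaves only the values 1 and 2.
  Then the sums are at most 1 with mean 1, hence equal to 1; but j = 1 is charged and gives the
  empty sum 0.\<close>

lemma reduced_pgf_fixed_point_subcritical:
  assumes "pmf xi 0 = 0" "pmf xi 1 > 0" "pmf_mean xi \<le> 2" "0 \<le> x" "x \<le> 1"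
    and fixp: "reduced_pgf xi x = x"
  shows "x = 1"
proof (rule ccontr)
  assume "x \<noteq> 1"
  with assms have x: "0 \<le> x" "x < 1" by auto
  have pos: "j \<noteq> 0" if "j \<in> set_pmf xi" for j using assms(1) that by (metis set_pmf_iff)
  have nn: "(\<integral>\<^sup>+ j. ennreal (real j) \<partial>measure_pmf xi) \<le> 2"
    using assms(3) by (simp add: pmf_mean_def ennreal_of_nat_eq_real_of_nat)
  have int: "integrable (measure_pmf xi) real"
    by (rule integrableI_nonneg) (use nn in \<open>auto intro: le_less_trans\<close>)
  have "ennreal (measure_pmf.expectation xi real) \<le> 2"
    using nn nn_integral_eq_integral[OF int] by simp
  then have mean: "measure_pmf.expectation xi real \<le> 2"
    using ennreal_le_iff[of 2 "measure_pmf.expectation xi real"] by simp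
  let ?G = "\<lambda>j. \<Sum>i<j - 1. x ^ i"
  have int': "integrable (measure_pmf xi) (\<lambda>j. real j - 1)" using int by simp
  have G1: "measure_pmf.expectation xi ?G = 1"
    using fixp reduced_pgf_fixed_point_iff[OF x] by simp
  have G_eq: "?G j = real j - 1" if "j \<in> set_pmf xi" for j
  proof (rule expectation_pmf_eq_imp_eq[OF reduced_pgf_geometric_sum(1)[OF x] int' _ _ that])
    fix j assume "j \<in> set_pmf xi"
    have "?G j \<le> (\<Sum>i<j - 1. 1)" using x by (intro sum_mono power_le_one) auto
    with pos[OF \<open>j \<in> set_pmf xi\<close>] show "?G j \<le> real j - 1" by simp
  next
    show "measure_pmf.expectation xi (\<lambda>j. real j - 1) \<le> measure_pmf.expectation xi ?G"
      using mean int by (simp add: G1 del: One_nat_def)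
  qed
  have le2: "j \<le> 2" if "j \<in> set_pmf xi" for j
  proof (rule ccontr)
    assume "\<not> j \<le> 2"
    with geometric_sum_strict_mono[OF x, of "j - 1"] have "?G j < real j - 1" by simp
    with G_eq[OF that] show False by simp
  qed
  have one: "1 \<in> set_pmf xi" using assms(2) by (auto simp: set_pmf_iff)
  have "?G 1 = 1"
  proof (rule expectation_pmf_eq_imp_eq[OF reduced_pgf_geometric_sum(1)[OF x] _ _ _ one])
    fix j assume j: "j \<in> set_pmf xi"
    show "?G j \<le> 1" unfolding G_eq[OF j] using le2[OF j] by simp
  qed (simp_all add: G1[simplified])
  then show False by simp
qed

text \<open>Otherwise all geometric sums with ratio r < 1 have mean at most 1, and Fatou's lemma for
  r tending to 1 bounds the mean of \<open>xi - 1\<close> by 1. Working with nonnegative integrals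
  covers infinite mean as well.\<close>

lemma reduced_pgf_supersolution_supercritical:
  assumes "pmf xi 0 = 0" "pmf_mean xi > 2"
  shows "\<exists>r. 0 \<le> r \<and> r < 1 \<and> reduced_pgf xi r \<le> r"
proof (rule ccontr)
  assume "\<not> ?thesis"
  then have no: "r < reduced_pgf xi r" if "0 \<le> r" "r < 1" for r
    using that by (meson not_le)
  have pos: "j \<noteq> 0" if "j \<in> set_pmf xi" for j using assms(1) that by (metis set_pmf_iff)
  define r where "r n = 1 - 1 / real (Suc n)" for n
  have r: "0 \<le> r n" "r n < 1" for n by (auto simp: r_def)
  have r_lim: "r \<longlonglongrightarrow> 1"
    unfolding r_def using LIMSEQ_inverse_real_of_nat_add_minus[of 1] by (simp add: divide_inverse)
  have G_le: "(\<integral>\<^sup>+ j. ennreal (\<Sum>i<j - 1. r n ^ i) \<partial>measure_pmf xi) \<le> 1" for n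
  proof -
    have "(1 - r n) * measure_pmf.expectation xi (\<lambda>j. \<Sum>i<j - 1. r n ^ i) \<le> (1 - r n) * 1"
      unfolding reduced_pgf_geometric_sum(2)[OF r, symmetric] using no[OF r, of n] by simp
    then have "measure_pmf.expectation xi (\<lambda>j. \<Sum>i<j - 1. r n ^ i) \<le> 1"
      using r[of n] by (subst (asm) mult_le_cancel_left_pos) auto
    then show ?thesis
      using r[of n] by (subst nn_integral_eq_integral[OF reduced_pgf_geometric_sum(1)[OF r]])
        (auto intro!: sum_nonneg)
  qed
  have "(\<integral>\<^sup>+ j. ennreal (real (j - 1)) \<partial>measure_pmf xi)
      = (\<integral>\<^sup>+ j. liminf (\<lambda>n. ennreal (\<Sum>i<j - 1. r n ^ i)) \<partial>measure_pmf xi)"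
  proof (rule nn_integral_cong)
    fix j
    have "(\<lambda>n. ennreal (\<Sum>i<j - 1. r n ^ i)) \<longlonglongrightarrow> ennreal (\<Sum>i<j - 1. 1 ^ i)"
      by (intro tendsto_ennrealI tendsto_sum tendsto_power r_lim)
    then show "ennreal (real (j - 1)) = liminf (\<lambda>n. ennreal (\<Sum>i<j - 1. r n ^ i))"
      by (subst lim_imp_Liminf) auto
  qed
  also have "\<dots> \<le> liminf (\<lambda>n. \<integral>\<^sup>+ j. ennreal (\<Sum>i<j - 1. r n ^ i) \<partial>measure_pmf xi)"
    by (rule nn_integral_liminf) simp
  also have "\<dots> \<le> liminf (\<lambda>n. 1)"
    by (rule Liminf_mono) (use G_le in auto)
  also have "\<dots> = 1" by (simp add: Liminf_const)
  finally have le1: "(\<integral>\<^sup>+ j. ennreal (real (j - 1)) \<partial>measure_pmf xi) \<le> 1" .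
  have "pmf_mean xi = (\<integral>\<^sup>+ j. ennreal (real (j - 1)) + 1 \<partial>measure_pmf xi)"
    unfolding pmf_mean_def
  proof (rule nn_integral_cong_AE, simp add: AE_measure_pmf_iff, intro ballI)
    fix j assume "j \<in> set_pmf xi"
    then obtain l where "j = Suc l" using pos by (cases j) auto
    then show "of_nat j = ennreal (real (j - Suc 0)) + 1"
      by (simp add: ennreal_of_nat_eq_real_of_nat add.commute flip: ennreal_1)
  qed
  also have "\<dots> = (\<integral>\<^sup>+ j. ennreal (real (j - 1)) \<partial>measure_pmf xi) + 1"
    by (subst nn_integral_add) auto
  also have "\<dots> \<le> 1 + 1" using le1 by (rule add_right_mono)
  finally show False using assms(2) by (simp add: one_add_one leD)
qed

text \<open>For fixed points x < y the geometric sums have the same mean 1, although those for y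
  dominate those for x. So they agree on the support, which excludes values above 2 and contradicts
  the mean.\<close>

lemma reduced_pgf_fixed_point_unique:
  assumes "pmf_mean xi > 2" and x: "0 \<le> x" "x < 1" "reduced_pgf xi x = x"
    and y: "0 \<le> y" "y < 1" "reduced_pgf xi y = y"
  shows "x = y"
proof -
  have False if xy: "0 \<le> x" "x < y" "y < 1" "reduced_pgf xi x = x" "reduced_pgf xi y = y" for x y
  proof -
    from xy have y: "0 \<le> y" "y < 1" and x: "0 \<le> x" "x < 1" by auto
    have "j \<le> 2" if "j \<in> set_pmf xi" for j
    proof (rule ccontr)
      assume "\<not> j \<le> 2"
      with geometric_sum_strict_mono[OF xy(1,2), of "j - 1"]
      have "(\<Sum>i<j - 1. x ^ i) < (\<Sum>i<j - 1. y ^ i)" by simp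
      moreover have "(\<Sum>i<j - 1. x ^ i) = (\<Sum>i<j - 1. y ^ i)"
        using that
      proof (rule expectation_pmf_eq_imp_eq[rotated -1])
        show "measure_pmf.expectation xi (\<lambda>j. \<Sum>i<j - 1. y ^ i)
            \<le> measure_pmf.expectation xi (\<lambda>j. \<Sum>i<j - 1. x ^ i)"
          using xy(4,5) reduced_pgf_fixed_point_iff[OF x] reduced_pgf_fixed_point_iff[OF y] by simp
        show "(\<Sum>i<j - 1. x ^ i) \<le> (\<Sum>i<j - 1. y ^ i)" for j
          using xy by (intro sum_mono power_mono) auto
      qed (rule reduced_pgf_geometric_sum x y)+
      ultimately show False by simp
    qed
    then have "pmf_mean xi \<le> (\<integral>\<^sup>+ j. 2 \<partial>measure_pmf xi)"
      unfolding pmf_mean_def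
      by (intro nn_integral_mono_AE)
        (auto simp: AE_measure_pmf_iff of_nat_le_iff[of _ 2, simplified])
    then show False using assms(1) by (simp add: leD)
  qed
  with x y show ?thesis by (meson linorder_neqE_linordered_idom)
qed

lemma eventual_absorption_prob_cases:
  assumes p0: "pmf xi 0 = 0" and p: "p = eventual_absorption_prob xi 1"
  shows "p\<^sup>2 = pgf xi p"
    and "pmf xi 1 = 0 \<Longrightarrow> p = 0"
    and "pmf_mean xi \<le> 2 \<Longrightarrow> pmf xi 1 > 0 \<Longrightarrow> p = 1"
    and "pmf_mean xi > 2 \<Longrightarrow> pmf xi 1 > 0 \<Longrightarrow> 0 < p \<and> p < 1"
    and "pmf_mean xi > 2 \<Longrightarrow> 0 < p \<Longrightarrow> p < 1 \<Longrightarrow> 0 < x \<Longrightarrow> x < 1 \<Longrightarrow> x\<^sup>2 = pgf xi x \<Longrightarrow> x = p"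
proof -
  have p01: "0 \<le> p" "p \<le> 1"
    unfolding p by (rule eventual_absorption_prob_nonneg eventual_absorption_prob_le_1)+
  have fixp: "reduced_pgf xi p = p" unfolding p by (rule reduced_pgf_eventual_absorption_prob[OF p0])
  \<comment> \<open>\<open>p\<close> is the least supersolution in [0, 1]; upper bounds on
    \<open>p\<close> follow by exhibiting a suitable r.\<close>
  have minimal: "p \<le> r" if "0 \<le> r" "r \<le> 1" "reduced_pgf xi r \<le> r" for r
    using eventual_absorption_prob_le_power[OF p0 that, of 1] p by simp
  show "p\<^sup>2 = pgf xi p" using pgf_eq_reduced_pgf[OF p0 p01] by (simp add: fixp power2_eq_square)
  show "p = 0" if "pmf xi 1 = 0"
  proof -
    have "reduced_pgf xi 0 = measure_pmf.expectation xi (\<lambda>_. 0)"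
      unfolding reduced_pgf_def
    proof (rule integral_cong_AE; simp add: AE_measure_pmf_iff; intro ballI)
      fix j assume "j \<in> set_pmf xi"
      then have "j \<noteq> 0" "j \<noteq> 1" using p0 that by (metis set_pmf_iff)+
      then show "Suc 0 < j" by simp
    qed
    then show ?thesis using minimal[of 0] p01 by simp
  qed
  show "p = 1" if "pmf_mean xi \<le> 2" "pmf xi 1 > 0"
    using reduced_pgf_fixed_point_subcritical[OF p0 that(2,1) p01 fixp] .
  show "0 < p \<and> p < 1" if super: "pmf_mean xi > 2" "pmf xi 1 > 0"
  proof
    obtain r where "0 \<le> r" "r < 1" "reduced_pgf xi r \<le> r"
      using reduced_pgf_supersolution_supercritical[OF p0 super(1)] by blast
    with minimal[of r] show "p < 1" by simp
    \<comment> \<open>As 0 ^ (j - 1) is 1 at j = 1, a vanishing mean would exclude the value 1 from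
      the support.\<close>
    have "p \<noteq> 0"
    proof
      assume "p = 0"
      have "(0::real) = 0 ^ (1 - 1)"
      proof (rule expectation_pmf_eq_imp_eq[where f = "\<lambda>_. 0" and g = "\<lambda>j. 0 ^ (j - 1)"])
        show "measure_pmf.expectation xi (\<lambda>j. 0 ^ (j - 1)) \<le> measure_pmf.expectation xi (\<lambda>_. 0 :: real)"
          using fixp \<open>p = 0\<close> by (simp add: reduced_pgf_def)
        show "1 \<in> set_pmf xi" using super(2) by (auto simp: set_pmf_iff)
      qed auto
      then show False by simp
    qed
    then show "0 < p" using p01 by simp
  qed
  show "x = p" if "pmf_mean xi > 2" "0 < p" "p < 1" "0 < x" "x < 1" "x\<^sup>2 = pgf xi x"
  proof (rule reduced_pgf_fixed_point_unique[OF that(1)])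
    have "x * x = x * reduced_pgf xi x"
      using that pgf_eq_reduced_pgf[OF p0, of x] by (simp add: power2_eq_square)
    then show "reduced_pgf xi x = x" using that by simp
  qed (use that p01 fixp in auto)
qed

section \<open>Positions of the game\<close>

locale maker_breaker_game =
  fixes st :: player and mk br :: strategy
  assumes legal_maker: "legal_strategy st Maker mk"
    and legal_breaker: "legal_strategy st Breaker br"
begin

text \<open>One turn as a map on histories: the game can be restarted from any position, and
  inductions can peel off the first turn.\<close>

definition step :: "(node \<Rightarrow> nat) \<Rightarrow> node list \<Rightarrow> node list" where
  "step X h =
     (if external X st h = {} then h
      else h @ [(if turn st (length h) = Maker then mk else br) h (visible X st h)])"

lemma history_eq_funpow: "history st mk br X t = (step X ^^ t) []"
  by (induction t) (simp_all add: step_def Let_def)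

lemma finite_internal [simp]: "finite (internal st h)"
  unfolding internal_def by simp

lemma root_internal [simp]: "[] \<in> internal st h"
  unfolding internal_def by simp

lemma internal_Nil [simp]: "internal st [] = {[]}"
  unfolding internal_def by simp

lemma cut_Nil [simp]: "cut st [] = {}"
  unfolding cut_def by simp

lemma internal_snoc:
  "internal st (h @ [w]) =
     (if turn st (length h) = Maker then insert w (internal st h) else internal st h)"
proof -
  have "{(h @ [w]) ! i | i. i < length (h @ [w]) \<and> turn st i = Maker}
      = {h ! i | i. i < length h \<and> turn st i = Maker}
        \<union> (if turn st (length h) = Maker then {w} else {})"
    by (force simp: nth_append less_Suc_eq)
  then show ?thesis unfolding internal_def by auto
qed

lemma cut_snoc:
  "cut st (h @ [w]) =
     (if turn st (length h) = Breaker then insert w (cut st h) else cut st h)"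
proof -
  have "{(h @ [w]) ! i | i. i < length (h @ [w]) \<and> turn st i = Breaker}
      = {h ! i | i. i < length h \<and> turn st i = Breaker}
        \<union> (if turn st (length h) = Breaker then {w} else {})"
    by (force simp: nth_append less_Suc_eq)
  then show ?thesis unfolding cut_def by auto
qed

lemma internal_subset: "internal st h \<subseteq> insert [] (set h)"
  unfolding internal_def by auto

lemma cut_subset: "cut st h \<subseteq> set h"
  unfolding cut_def by auto

lemma finite_external [simp]: "finite (external X st h)"
proof -
  have "external X st h \<subseteq> (\<Union>v\<in>internal st h. (\<lambda>i. v @ [i]) ` {..<X v})"
    unfolding external_def by auto
  then show ?thesis by (rule finite_subset) auto
qed

lemma external_cong:
  assumes "\<And>v. v \<in> internal st h \<Longrightarrow> X v = Y v"
  shows "external X st h = external Y st h"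
  using assms unfolding external_def by auto

lemma visible_cong:
  assumes "\<And>v. v \<in> internal st h \<Longrightarrow> X v = Y v"
  shows "visible X st h = visible Y st h"
  using assms unfolding visible_def by auto

text \<open>The no-information regime enters here: the playable edges and the visible part depend
  only on the offspring of internal nodes, hence so does the next move.\<close>

lemma step_cong:
  assumes "\<And>v. v \<in> internal st h \<Longrightarrow> X v = Y v"
  shows "step X h = step Y h"
  unfolding step_def using external_cong[OF assms] visible_cong[OF assms] by simp

lemma step_cases:
  assumes "external X st h \<noteq> {}"
  obtains w where "w \<in> external X st h" "step X h = h @ [w]"
proof -
  have "(if turn st (length h) = Maker then mk else br) h (visible X st h) \<in> external X st h"
    using legal_maker legal_breaker assms unfolding legal_strategy_def
    by (cases "turn st (length h)") auto
  with that assms show ?thesis unfolding step_def by auto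
qed

lemma funpow_step_stuck: "external X st h = {} \<Longrightarrow> (step X ^^ t) h = h"
  by (induction t) (auto simp: step_def)

text \<open>An invariant of legal play. By its last clause, the children of a node that is not
  internal are still unplayed.\<close>

definition valid_position :: "(node \<Rightarrow> nat) \<Rightarrow> node list \<Rightarrow> bool" where
  "valid_position X h \<longleftrightarrow>
     [] \<notin> set h \<and> internal st h \<inter> cut st h = {} \<and>
     (\<forall>v i. v @ [i] \<in> set h \<longrightarrow> v \<in> internal st h \<and> i < X v)"

lemma valid_position_Nil [simp]: "valid_position X []"
  by (simp add: valid_position_def)

lemma valid_position_snoc:
  assumes "valid_position X h" "w \<in> external X st h"
  shows "valid_position X (h @ [w])"
  using assms unfolding valid_position_def external_def
  by (auto simp: internal_snoc cut_snoc)

lemma valid_position_cong: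
  assumes "\<And>v. v \<in> internal st h \<Longrightarrow> X v = Y v"
  shows "valid_position X h \<longleftrightarrow> valid_position Y h"
proof -
  have "v \<in> internal st h \<and> i < X v \<longleftrightarrow> v \<in> internal st h \<and> i < Y v" for v i
    using assms[of v] by auto
  then show ?thesis by (simp only: valid_position_def)
qed

lemma valid_position_step: "valid_position X h \<Longrightarrow> valid_position X (step X h)"
proof (cases "external X st h = {}")
  case False
  then obtain w where "w \<in> external X st h" "step X h = h @ [w]" by (rule step_cases)
  then show "valid_position X h \<Longrightarrow> valid_position X (step X h)"
    by (simp add: valid_position_snoc)
qed (simp add: step_def)

lemma valid_position_funpow: "valid_position X h \<Longrightarrow> valid_position X ((step X ^^ t) h)"
  by (induction t) (auto intro: valid_position_step)

section \<open>Number of available edges\<close>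

lemma card_external_Nil: "card (external X st []) = X []"
proof -
  have "external X st [] = (\<lambda>i. [i]) ` {..<X []}" unfolding external_def by auto
  then show ?thesis by (simp add: card_image inj_on_def)
qed

lemma card_external_breaker:
  assumes "w \<in> external X st h" "turn st (length h) = Breaker"
  shows "card (external X st (h @ [w])) = card (external X st h) - 1"
proof -
  have "external X st (h @ [w]) = external X st h - {w}"
    using assms unfolding external_def by (auto simp: internal_snoc cut_snoc)
  then show ?thesis using assms by simp
qed

text \<open>As \<open>w\<close> is not yet internal, none of its child edges has been played, so all
  \<open>X w\<close> of them become available. With the edge lost on Breaker's turn this gives the
  step \<open>xi - 2\<close> of the walk.\<close>

lemma card_external_maker:
  assumes "valid_position X h" "w \<in> external X st h" "turn st (length h) = Maker"
  shows "card (external X st (h @ [w])) = card (external X st h) - 1 + X w"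
proof -
  let ?C = "(\<lambda>i. w @ [i]) ` {..<X w}"
  have w: "w \<notin> internal st h" "w \<noteq> []" using assms(2) unfolding external_def by auto
  then have new: "w @ [i] \<notin> set h" for i using assms(1) unfolding valid_position_def by blast
  have fresh: "w @ [i] \<notin> internal st h" "w @ [i] \<notin> cut st h" for i
    using new[of i] internal_subset[of h] cut_subset[of h] by auto
  have "external X st (h @ [w]) = (external X st h - {w}) \<union> ?C"
    using assms(3) fresh unfolding external_def by (auto simp: internal_snoc cut_snoc)
  moreover have "(external X st h - {w}) \<inter> ?C = {}"
    using w unfolding external_def by auto
  ultimately have "card (external X st (h @ [w])) = card (external X st h - {w}) + card ?C"
    by (simp add: card_Un_disjoint)
  then show ?thesis using assms(2) by (simp add: card_image inj_on_def)
qed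

section \<open>Finite root components\<close>

lemma root_component_subset_internal:
  assumes "external X st h = {}"
  shows "root_component X (cut st h) \<subseteq> internal st h"
proof
  fix v assume "v \<in> root_component X (cut st h)"
  then show "v \<in> internal st h"
  proof induction
    case (child v i)
    then show ?case using assms unfolding external_def by blast
  qed simp
qed

lemma internal_subset_root_component:
  assumes "valid_position X h"
  shows "internal st h \<subseteq> root_component X (cut st h)"
proof
  fix v assume "v \<in> internal st h"
  then show "v \<in> root_component X (cut st h)"
  proof (induction v rule: rev_induct)
    case (snoc i v)
    then have "v @ [i] \<in> set h" using internal_subset[of h] by auto
    with snoc assms show ?case
      unfolding valid_position_def by (blast intro: root_component.child)
  qed (rule root_component.root)
qed

text \<open>An uncut external edge leads to an unplayed infinite ray, here the one of first children.\<close>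

lemma infinite_root_component:
  assumes "valid_position X h" "e \<in> external X st h" and pos: "\<And>v. 0 < X v"
  shows "infinite (root_component X (cut st h))"
proof -
  let ?ray = "\<lambda>n. e @ replicate n 0"
  obtain v i where e: "e = v @ [i]" "v \<in> internal st h" "i < X v" "e \<notin> internal st h" "e \<notin> cut st h"
    using assms(2) unfolding external_def by auto
  have ray: "?ray n \<notin> internal st h \<and> ?ray n \<in> root_component X (cut st h)" for n
  proof (induction n)
    case 0
    then show ?case
      using e internal_subset_root_component[OF assms(1)] by (auto intro: root_component.child)
  next
    case (Suc n)
    have eq: "?ray (Suc n) = ?ray n @ [0]" by (simp add: replicate_append_same)
    have "?ray n @ [0] \<notin> set h"
      using Suc assms(1) unfolding valid_position_def by blast
    then have "?ray n @ [0] \<notin> internal st h" "?ray n @ [0] \<notin> cut st h"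
      using internal_subset[of h] cut_subset[of h] by auto
    with Suc pos show ?case
      unfolding eq by (blast intro: root_component.child)
  qed
  have "inj ?ray" by (rule injI) (auto dest: arg_cong[of _ _ length])
  then have "infinite (range ?ray)" by (rule range_inj_infinite)
  moreover have "range ?ray \<subseteq> root_component X (cut st h)" using ray by auto
  ultimately show ?thesis using finite_subset by blast
qed

text \<open>Without external edges the root component lies in the finite set of internal nodes; any
  external edge carries an infinite ray, because all offspring numbers are positive.\<close>

lemma breaker_wins_iff:
  assumes "\<And>v. 0 < X v"
  shows "breaker_wins st mk br X \<longleftrightarrow> (\<exists>t. external X st ((step X ^^ t) []) = {})"
proof -
  have "finite (root_component X (cut st h)) \<longleftrightarrow> external X st h = {}"
    if "valid_position X h" for h
  proof
    show "external X st h = {}" if "finite (root_component X (cut st h))"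
      using infinite_root_component[OF \<open>valid_position X h\<close> _ assms] that by auto
    show "finite (root_component X (cut st h))" if "external X st h = {}"
      by (rule finite_subset[OF root_component_subset_internal[OF that] finite_internal])
  qed
  then show ?thesis
    unfolding breaker_wins_def history_eq_funpow using valid_position_funpow[OF valid_position_Nil]
    by blast
qed

end

section \<open>The game on the Galton--Watson tree\<close>

lemma turn_Suc:
  "turn st (Suc n) = Maker \<longleftrightarrow> turn st n = Breaker"
  "turn st (Suc n) = Breaker \<longleftrightarrow> turn st n = Maker"
  by (cases st; simp add: turn_def)+

text \<open>Expresses finiteness by countable quantifiers over membership, as needed for the
  measurability of \<open>breaker_wins\<close>.\<close>

lemma finite_iff_bounded_to_nat:
  fixes A :: "'a::countable set"
  shows "finite A \<longleftrightarrow> (\<exists>n. \<forall>v. v \<in> A \<longrightarrow> to_nat v < n)"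
proof -
  have "finite A \<longleftrightarrow> finite (to_nat ` A)"
    by (rule finite_image_iff[symmetric]) (rule inj_on_subset[OF inj_to_nat], simp)
  then show ?thesis by (auto simp: finite_nat_set_iff_bounded)
qed

text \<open>Membership of \<open>v\<close> is decided along the path from the root to
  \<open>v\<close>, hence by finitely many addresses.\<close>

lemma root_component_cong_prefixes:
  assumes "v \<in> root_component X C" and "\<And>m. X (take m v) = Y (take m v)"
  shows "v \<in> root_component Y C"
  using assms
proof induction
  case (child v i)
  have "X (take m v) = Y (take m v)" for m
    using child.prems[of "min m (length v)"] by (cases "m \<le> length v") auto
  moreover have "X v = Y v" using child.prems[of "length v"] by simp
  ultimately show ?case using child by (auto intro: root_component.child)
qed (rule root_component.root)

locale galton_watson_game = maker_breaker_game st mk br + prob_space M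
  for st mk br and M :: "'w measure" +
  fixes xi :: "nat pmf" and N :: "node \<Rightarrow> 'w \<Rightarrow> nat"
  assumes indep: "indep_vars (\<lambda>_. count_space UNIV) N UNIV"
    and distr_N: "\<And>v. distr M (count_space UNIV) (N v) = measure_pmf xi"
begin

section \<open>Cylinder events of the offspring numbers\<close>

definition offspring :: "'w \<Rightarrow> node \<Rightarrow> nat" where
  "offspring \<omega> v = N v \<omega>"

lemma measurable_N [measurable]: "N v \<in> M \<rightarrow>\<^sub>M count_space UNIV"
  using indep unfolding indep_vars_def by simp

lemma prob_N_eq: "prob (N v -` {k} \<inter> space M) = pmf xi k"
proof -
  have "pmf xi k = measure (distr M (count_space UNIV) (N v)) {k}"
    by (simp add: distr_N pmf.rep_eq)
  then show ?thesis by (simp add: measure_distr)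
qed

text \<open>With \<open>F\<close> the set of internal nodes, this is the event that the offspring
  numbers seen so far are those of \<open>x\<close>.\<close>

definition agree :: "node set \<Rightarrow> (node \<Rightarrow> nat) \<Rightarrow> 'w set" where
  "agree F x = {\<omega> \<in> space M. \<forall>v\<in>F. N v \<omega> = x v}"

lemma sets_agree [measurable]: "agree F x \<in> events"
  unfolding agree_def by measurable

lemma prob_agree:
  assumes "finite F"
  shows "prob (agree F x) = (\<Prod>v\<in>F. pmf xi (x v))"
proof (cases "F = {}")
  case True
  then show ?thesis by (simp add: agree_def prob_space)
next
  case False
  have "agree F x = (\<Inter>v\<in>F. N v -` {x v} \<inter> space M)"
    using False unfolding agree_def by auto
  then show ?thesis
    using indep_varsD[OF indep False assms, of "\<lambda>v. {x v}"] by (simp add: prob_N_eq)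
qed

lemma agree_insert:
  assumes "w \<notin> F"
  shows "\<omega> \<in> agree (insert w F) (x(w := j)) \<longleftrightarrow> \<omega> \<in> agree F x \<and> N w \<omega> = j"
  using assms unfolding agree_def by auto

lemma prob_agree_insert:
  assumes "finite F" "w \<notin> F"
  shows "prob (agree (insert w F) (x(w := j))) = prob (agree F x) * pmf xi j"
proof -
  have "(\<Prod>v\<in>F. pmf xi ((x(w := j)) v)) = (\<Prod>v\<in>F. pmf xi (x v))"
    using assms by (intro prod.cong) auto
  with assms show ?thesis by (simp add: prob_agree)
qed

text \<open>Total probability over the offspring number of a further node \<open>w\<close>: the
  cylinder is a countable disjoint union, so measurability also passes from the pieces to the
  whole.\<close>

lemma
  assumes "w \<notin> F" and meas: "\<And>j. {\<omega> \<in> agree (insert w F) (x(w := j)). P \<omega>} \<in> events"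
  shows sets_agree_split: "{\<omega> \<in> agree F x. P \<omega>} \<in> events"
    and prob_agree_split:
      "(\<lambda>j. prob {\<omega> \<in> agree (insert w F) (x(w := j)). P \<omega>}) sums prob {\<omega> \<in> agree F x. P \<omega>}"
proof -
  let ?A = "\<lambda>j. {\<omega> \<in> agree (insert w F) (x(w := j)). P \<omega>}"
  have eq: "{\<omega> \<in> agree F x. P \<omega>} = (\<Union>j. ?A j)"
    unfolding agree_insert[OF assms(1)] by auto
  show "{\<omega> \<in> agree F x. P \<omega>} \<in> events" unfolding eq using meas by auto
  have "disjoint_family ?A"
    unfolding disjoint_family_on_def agree_insert[OF assms(1)] by auto
  then show "(\<lambda>j. prob (?A j)) sums prob {\<omega> \<in> agree F x. P \<omega>}"
    unfolding eq using meas by (intro finite_measure_UNION) auto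
qed

lemma agree_offspring: "\<omega> \<in> agree F x \<Longrightarrow> v \<in> F \<Longrightarrow> offspring \<omega> v = x v"
  by (simp add: agree_def offspring_def)

section \<open>Probability that the available edges run out\<close>

definition over :: "nat \<Rightarrow> node list \<Rightarrow> 'w \<Rightarrow> bool" where
  "over t h \<omega> \<longleftrightarrow> external (offspring \<omega>) st ((step (offspring \<omega>) ^^ t) h) = {}"

lemma over_Suc: "over (Suc t) h \<omega> \<longleftrightarrow> over t (step (offspring \<omega>) h) \<omega>"
  by (simp add: over_def funpow_swap1)

lemma over_mono: "over s h \<omega> \<Longrightarrow> s \<le> t \<Longrightarrow> over t h \<omega>"
proof -
  assume "over s h \<omega>" "s \<le> t"
  then obtain d where "t = d + s" by (metis add.commute le_Suc_ex)
  with \<open>over s h \<omega>\<close> show ?thesis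
    by (simp add: over_def funpow_add funpow_step_stuck)
qed

lemma agree_over_stuck:
  assumes "external x st h = {}"
  shows "{\<omega> \<in> agree (internal st h) x. over t h \<omega>} = agree (internal st h) x"
proof -
  have "over t h \<omega>" if "\<omega> \<in> agree (internal st h) x" for \<omega>
  proof (rule over_mono)
    show "over 0 h \<omega>"
      using assms external_cong[of h "offspring \<omega>" x] agree_offspring[OF that]
      by (simp add: over_def)
  qed simp
  then show ?thesis by auto
qed

text \<open>On the cylinder of the internal nodes the next history is the same for all outcomes, so
  the turn can be computed from the representative \<open>x\<close>.\<close>

lemma agree_over_Suc:
  assumes "step x h = h'"
  shows "\<omega> \<in> agree (internal st h) x \<Longrightarrow> over (Suc t) h \<omega> \<longleftrightarrow> over t h' \<omega>"
  using step_cong[of h "offspring \<omega>" x] agree_offspring[of \<omega> "internal st h" x] assms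
  by (simp add: over_Suc)

text \<open>A conditional probability given what has been seen, in product form because the cylinder
  may have probability 0. \<open>t\<close> counts the turns of both players and \<open>n\<close>
  those of Maker; \<open>k\<close> stands for the number of edges at Maker's next turn.\<close>

definition position_claim :: "nat \<Rightarrow> nat \<Rightarrow> node list \<Rightarrow> (node \<Rightarrow> nat) \<Rightarrow> nat \<Rightarrow> bool" where
  "position_claim t n h x k \<longleftrightarrow>
     {\<omega> \<in> agree (internal st h) x. over t h \<omega>} \<in> events \<and>
     prob {\<omega> \<in> agree (internal st h) x. over t h \<omega>}
       = prob (agree (internal st h) x) * absorption_prob xi n k"

lemma position_claim_stuck:
  assumes "external x st h = {}"
  shows "position_claim t n h x 0"
  unfolding position_claim_def agree_over_stuck[OF assms] by (simp add: sets_agree)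

text \<open>Breaker's turn reveals no offspring number: it uses up a turn and one edge, but no step
  of the walk.\<close>

lemma position_claim_breaker:
  assumes maker: "\<And>h x. valid_position x h \<Longrightarrow> turn st (length h) = Maker
      \<Longrightarrow> position_claim t n h x (card (external x st h))"
    and h: "valid_position x h" "turn st (length h) = Breaker"
  shows "position_claim (Suc t) n h x (card (external x st h) - 1)"
proof (cases "external x st h = {}")
  case True
  then show ?thesis using position_claim_stuck by simp
next
  case False
  then obtain w where w: "w \<in> external x st h" "step x h = h @ [w]" by (rule step_cases)
  have "position_claim t n (h @ [w]) x (card (external x st (h @ [w])))"
    using h w by (intro maker valid_position_snoc) (auto simp: turn_Suc)
  moreover have "{\<omega> \<in> agree (internal st h) x. over (Suc t) h \<omega>}
      = {\<omega> \<in> agree (internal st h) x. over t (h @ [w]) \<omega>}"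
    using agree_over_Suc[OF w(2)] by blast
  ultimately show ?thesis
    using h(2) card_external_breaker[OF w(1) h(2)] by (simp add: position_claim_def internal_snoc)
qed

text \<open>Deferred decisions: the node fixated by Maker depends only on the offspring of the internal
  nodes, so conditionally on these its own offspring number still has law \<open>xi\<close>.\<close>

lemma position_claim_maker:
  assumes "valid_position x h" "turn st (length h) = Maker"
  shows "position_claim (2 * n) n h x (card (external x st h))"
  using assms
proof (induction n arbitrary: h x)
  case 0
  show ?case
  proof (cases "external x st h = {}")
    case True
    then show ?thesis using position_claim_stuck by simp
  next
    case False
    have "external (offspring \<omega>) st h = external x st h" if "\<omega> \<in> agree (internal st h) x" for \<omega>
      by (rule external_cong) (rule agree_offspring[OF that])
    with False have "{\<omega> \<in> agree (internal st h) x. over 0 h \<omega>} = {}"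
      by (auto simp: over_def)
    then have "position_claim 0 0 h x (card (external x st h))"
      unfolding position_claim_def by (simp only:) (use False in simp)
    then show ?thesis by simp
  qed
next
  case (Suc n)
  show ?case
  proof (cases "external x st h = {}")
    case True
    then show ?thesis using position_claim_stuck by simp
  next
    case False
    then obtain w where w: "w \<in> external x st h" "step x h = h @ [w]" by (rule step_cases)
    let ?F = "internal st h" and ?k = "card (external x st h)"
    let ?P = "over (Suc (2 * n)) (h @ [w])"
    have w_new: "w \<notin> ?F" using w(1) unfolding external_def by auto
    have F': "internal st (h @ [w]) = insert w ?F" using Suc.prems(2) by (simp add: internal_snoc)
    have k_ne: "?k \<noteq> 0" using False by simp
    \<comment> \<open>Maker's turn leaves \<open>?k - 1 + j\<close> edges and Breaker's reply takes
      one, as in the recursion of \<open>absorption_prob\<close>. Truncation covers the case that no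
      edge is left for Breaker.\<close>
    have claim: "position_claim (Suc (2 * n)) n (h @ [w]) (x(w := j)) (?k - 1 + j - 1)" for j
    proof -
      let ?x = "x(w := j)"
      have same: "?x v = x v" if "v \<in> ?F" for v using that w_new by auto
      have ext: "external ?x st h = external x st h" by (rule external_cong) (rule same)
      have valid: "valid_position ?x h"
        using valid_position_cong[of h ?x x, OF same] Suc.prems(1) by simp
      have "position_claim (Suc (2 * n)) n (h @ [w]) ?x (card (external ?x st (h @ [w])) - 1)"
        using valid w ext Suc.prems(2)
        by (intro position_claim_breaker Suc.IH valid_position_snoc) (auto simp: turn_Suc)
      then show ?thesis
        using card_external_maker[OF valid, of w] w ext Suc.prems(2) by simp
    qed
    have meas: "{\<omega> \<in> agree (insert w ?F) (x(w := j)). ?P \<omega>} \<in> events" for j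
      using claim[of j] by (simp add: position_claim_def F')
    have prob: "prob {\<omega> \<in> agree (insert w ?F) (x(w := j)). ?P \<omega>}
        = prob (agree ?F x) * (pmf xi j * absorption_prob xi n (?k - 1 + j - 1))" for j
      using claim[of j] prob_agree_insert[OF finite_internal w_new, of x j]
      by (simp add: position_claim_def F')
    have "prob {\<omega> \<in> agree ?F x. ?P \<omega>} = prob (agree ?F x) * absorption_prob xi (Suc n) ?k"
    proof (rule sums_unique2)
      show "(\<lambda>j. prob (agree ?F x) * (pmf xi j * absorption_prob xi n (?k - 1 + j - 1)))
          sums prob {\<omega> \<in> agree ?F x. ?P \<omega>}"
        using prob_agree_split[OF w_new meas] unfolding prob .
      have "(\<lambda>j. pmf xi j * absorption_prob xi n (?k - 1 + j - 1)) sums absorption_prob xi (Suc n) ?k"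
        using sums_expectation_nat_pmf[OF integrable_absorption_prob[of xi n "\<lambda>j. ?k - 1 + j - 1"]]
        by (simp only: absorption_prob.simps(2) k_ne if_False)
      then show "(\<lambda>j. prob (agree ?F x) * (pmf xi j * absorption_prob xi n (?k - 1 + j - 1)))
          sums (prob (agree ?F x) * absorption_prob xi (Suc n) ?k)"
        by (rule sums_mult)
    qed
    moreover have "{\<omega> \<in> agree ?F x. over (2 * Suc n) h \<omega>} = {\<omega> \<in> agree ?F x. ?P \<omega>}"
      using agree_over_Suc[OF w(2), of _ "Suc (2 * n)"] by auto
    ultimately show ?thesis
      unfolding position_claim_def using sets_agree_split[OF w_new meas] by simp
  qed
qed

text \<open>Revealing the root acts as a first step of the walk: from 2 - d, an offspring number j
  leads to j - d, the number of edges at Maker's first turn. Hence the starting values 2 and 1, and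
  the index \<open>Suc n\<close>.\<close>

lemma prob_over:
  defines "d \<equiv> (if st = Maker then 0 else 1)"
  shows "{\<omega> \<in> space M. over (2 * n + d) [] \<omega>} \<in> events
    \<and> prob {\<omega> \<in> space M. over (2 * n + d) [] \<omega>} = absorption_prob xi (Suc n) (2 - d)"
proof -
  let ?P = "over (2 * n + d) []"
  have claim: "position_claim (2 * n + d) n [] ((\<lambda>_. 0)([] := j)) (j - d)" for j
  proof (cases "st = Maker")
    case True
    then have turn: "turn st (length []) = Maker" and d: "d = 0"
      by (simp_all add: turn_def d_def)
    from position_claim_maker[OF valid_position_Nil turn, of n "(\<lambda>_. 0)([] := j)"] show ?thesis
      by (simp only: d card_external_Nil fun_upd_same add_0_right diff_zero)
  next
    case False
    then have turn: "turn st (length []) = Breaker" and d: "d = 1"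
      by (cases st; simp add: turn_def d_def)+
    from position_claim_breaker[OF position_claim_maker valid_position_Nil turn, of n "(\<lambda>_. 0)([] := j)"]
    show ?thesis
      by (simp only: d card_external_Nil fun_upd_same Suc_eq_plus1)
  qed
  have empty: "agree {} (\<lambda>_. 0) = space M" by (simp add: agree_def)
  have meas: "{\<omega> \<in> agree (insert [] {}) ((\<lambda>_. 0)([] := j)). ?P \<omega>} \<in> events" for j
    using claim[of j] by (simp add: position_claim_def)
  have prob: "prob {\<omega> \<in> agree (insert [] {}) ((\<lambda>_. 0)([] := j)). ?P \<omega>}
      = pmf xi j * absorption_prob xi n (j - d)" for j
    using claim[of j] prob_agree_insert[of "{}" "[]" "\<lambda>_. 0" j]
    by (simp add: position_claim_def empty prob_space)
  have "(\<lambda>j. pmf xi j * absorption_prob xi n (j - d)) sums prob {\<omega> \<in> space M. ?P \<omega>}"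
    using prob_agree_split[OF _ meas] unfolding prob empty by simp
  moreover have "(\<lambda>j. pmf xi j * absorption_prob xi n (j - d)) sums
      measure_pmf.expectation xi (\<lambda>j. absorption_prob xi n (j - d))"
    by (rule sums_expectation_nat_pmf) simp
  moreover have "absorption_prob xi (Suc n) (2 - d)
      = measure_pmf.expectation xi (\<lambda>j. absorption_prob xi n (j - d))"
    by (simp add: d_def)
  ultimately have "prob {\<omega> \<in> space M. ?P \<omega>} = absorption_prob xi (Suc n) (2 - d)"
    by (simp add: sums_unique2)
  with sets_agree_split[OF _ meas] show ?thesis by (simp add: empty)
qed

lemma prob_eventually_over:
  shows "{\<omega> \<in> space M. \<exists>t. over t [] \<omega>} \<in> events"
    and "prob {\<omega> \<in> space M. \<exists>t. over t [] \<omega>}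
      = eventual_absorption_prob xi (if st = Maker then 2 else 1)"
proof -
  define d :: nat where "d = (if st = Maker then 0 else 1)"
  let ?A = "\<lambda>n. {\<omega> \<in> space M. over (2 * n + d) [] \<omega>}"
  have meas: "?A n \<in> events" and prob: "prob (?A n) = absorption_prob xi (Suc n) (2 - d)" for n
    using prob_over[of n] unfolding d_def by auto
  have eq: "{\<omega> \<in> space M. \<exists>t. over t [] \<omega>} = (\<Union>n. ?A n)"
  proof (intro equalityI subsetI)
    fix \<omega> assume "\<omega> \<in> {\<omega> \<in> space M. \<exists>t. over t [] \<omega>}"
    then obtain t where "\<omega> \<in> space M" "over t [] \<omega>" by auto
    then have "\<omega> \<in> ?A t" using over_mono[of t "[]" \<omega> "2 * t + d"] by simp
    then show "\<omega> \<in> (\<Union>n. ?A n)" by blast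
  qed auto
  show "{\<omega> \<in> space M. \<exists>t. over t [] \<omega>} \<in> events" unfolding eq using meas by auto
  have "(\<lambda>n. prob (?A n)) \<longlonglongrightarrow> prob (\<Union>n. ?A n)"
  proof (rule finite_Lim_measure_incseq)
    show "incseq ?A"
    proof (rule incseq_SucI, rule subsetI)
      fix n \<omega> assume "\<omega> \<in> ?A n"
      then show "\<omega> \<in> ?A (Suc n)"
        using over_mono[of "2 * n + d" "[]" \<omega> "2 * Suc n + d"] by simp
    qed
  qed (use meas in auto)
  moreover have "(\<lambda>n. prob (?A n)) \<longlonglongrightarrow> eventual_absorption_prob xi (2 - d)"
    unfolding prob by (rule LIMSEQ_Suc) (rule LIMSEQ_absorption_prob)
  ultimately show "prob {\<omega> \<in> space M. \<exists>t. over t [] \<omega>}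
      = eventual_absorption_prob xi (if st = Maker then 2 else 1)"
    unfolding eq by (cases "st = Maker") (auto simp: d_def intro: LIMSEQ_unique)
qed

section \<open>Measurability of Breaker's win\<close>

lemma measurable_finitely_dependent:
  assumes "finite F" and dep: "\<And>X Y. (\<And>v. v \<in> F \<Longrightarrow> X v = Y v) \<Longrightarrow> P X \<Longrightarrow> P Y"
  shows "Measurable.pred M (\<lambda>\<omega>. P (offspring \<omega>))"
proof -
  \<comment> \<open>Assignments on the finite set \<open>F\<close> are countable in number, so the
    event is a countable union of cylinders.\<close>
  let ?R = "{x \<in> PiE F (\<lambda>_. UNIV). P x}"
  have "{\<omega> \<in> space M. P (offspring \<omega>)} = (\<Union>x\<in>?R. agree F x)"
  proof (intro equalityI subsetI)
    fix \<omega> assume \<omega>: "\<omega> \<in> {\<omega> \<in> space M. P (offspring \<omega>)}"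
    have "P (restrict (offspring \<omega>) F)" by (rule dep[of "offspring \<omega>"]) (use \<omega> in auto)
    with \<omega> show "\<omega> \<in> (\<Union>x\<in>?R. agree F x)"
      by (intro UN_I[of "restrict (offspring \<omega>) F"]) (auto simp: agree_def offspring_def)
  next
    fix \<omega> assume "\<omega> \<in> (\<Union>x\<in>?R. agree F x)"
    then obtain x where x: "P x" "\<omega> \<in> agree F x" by auto
    have "P (offspring \<omega>)" by (rule dep[OF _ x(1)]) (simp add: agree_offspring[OF x(2)])
    with x show "\<omega> \<in> {\<omega> \<in> space M. P (offspring \<omega>)}" by (simp add: agree_def)
  qed
  moreover have "countable ?R"
    by (rule countable_subset[of _ "PiE F (\<lambda>_. UNIV)"]) (auto intro: countable_PiE assms(1))
  ultimately have "{\<omega> \<in> space M. P (offspring \<omega>)} \<in> events"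
    using sets.countable_UN'[of ?R "agree F" M] sets_agree by auto
  then show ?thesis by (simp add: pred_def)
qed

text \<open>Internal nodes stay internal, so the offspring numbers of those of the final history
  \<open>h\<close> determine every earlier turn too.\<close>

lemma funpow_step_cong:
  assumes "(step X ^^ t) [] = h" "\<And>v. v \<in> internal st h \<Longrightarrow> X v = Y v"
  shows "(step Y ^^ t) [] = h"
  using assms
proof (induction t arbitrary: h)
  case (Suc t)
  define g where "g = (step X ^^ t) []"
  have h: "h = step X g" using Suc.prems(1) by (simp add: g_def)
  then have "internal st g \<subseteq> internal st h" by (auto simp: step_def internal_snoc)
  then have agr: "X v = Y v" if "v \<in> internal st g" for v using that Suc.prems(2) by blast
  have "(step Y ^^ t) [] = g" by (rule Suc.IH[OF g_def[symmetric] agr])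
  with h step_cong[OF agr] show ?case by simp
qed simp

lemma measurable_breaker_wins:
  "Measurable.pred M (\<lambda>\<omega>. breaker_wins st mk br (offspring \<omega>))"
proof -
  have [measurable]: "Measurable.pred M (\<lambda>\<omega>. (step (offspring \<omega>) ^^ t) [] = h)" for t h
    by (rule measurable_finitely_dependent[of "internal st h"]) (auto intro: funpow_step_cong)
  have [measurable]: "Measurable.pred M (\<lambda>\<omega>. v \<in> root_component (offspring \<omega>) C)" for v C
  proof (rule measurable_finitely_dependent)
    have "range (\<lambda>m. take m v) \<subseteq> (\<lambda>m. take m v) ` {..length v}"
    proof (rule image_subsetI)
      fix m
      have "take m v = take (min m (length v)) v" by (simp add: min_def)
      then show "take m v \<in> (\<lambda>m. take m v) ` {..length v}" by (rule image_eqI) simp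
    qed
    then show "finite (range (\<lambda>m. take m v))" by (rule finite_subset) simp
  qed (auto elim!: root_component_cong_prefixes)
  \<comment> \<open>Naming the history by a quantifier over a countable type reduces the event to
    ones that depend on finitely many addresses, although the strategies are arbitrary
    functions.\<close>
  have "breaker_wins st mk br X \<longleftrightarrow> (\<exists>t h n. (step X ^^ t) [] = h \<and>
      (\<forall>v. v \<in> root_component X (cut st h) \<longrightarrow> to_nat v < n))" for X
    unfolding breaker_wins_def history_eq_funpow finite_iff_bounded_to_nat by auto
  then show ?thesis by (simp only:) measurable
qed

text \<open>There are countably many addresses, so almost surely all offspring numbers are positive
  at once; then Breaker wins exactly when the edges run out.\<close>

lemma breaker_win_prob_eq:
  assumes "pmf xi 0 = 0"
  shows "breaker_win_prob M N st mk br = eventual_absorption_prob xi (if st = Maker then 2 else 1)"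
proof -
  have "AE \<omega> in M. 0 < N v \<omega>" for v
  proof -
    have "AE k in distr M (count_space UNIV) (N v). 0 < k"
      unfolding distr_N AE_measure_pmf_iff using assms by (metis (mono_tags) gr0I set_pmf_iff)
    then show ?thesis by (subst (asm) AE_distr_iff) auto
  qed
  then have "AE \<omega> in M. \<forall>v. 0 < offspring \<omega> v"
    by (simp add: AE_all_countable offspring_def)
  then have "AE \<omega> in M. breaker_wins st mk br (offspring \<omega>) \<longleftrightarrow> (\<exists>t. over t [] \<omega>)"
    by eventually_elim (simp add: breaker_wins_iff over_def)
  then have "prob {\<omega> \<in> space M. breaker_wins st mk br (offspring \<omega>)}
      = prob {\<omega> \<in> space M. \<exists>t. over t [] \<omega>}"
    using measurable_breaker_wins prob_eventually_over(1)
    by (intro finite_measure_eq_AE) (auto simp: pred_def)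
  then show ?thesis
    using prob_eventually_over(2) unfolding breaker_win_prob_def offspring_def[abs_def] by simp
qed

end

theorem theorem5p3:
  fixes M :: "'w measure" and xi :: "nat pmf" and N :: "node \<Rightarrow> 'w \<Rightarrow> nat"
    and mk br mk' br' :: strategy and p pbar :: real
  assumes "galton_watson M xi N"
    and "pmf xi 0 = 0"
    and "legal_strategy Breaker Maker mk" and "legal_strategy Breaker Breaker br"
    and "legal_strategy Maker Maker mk'" and "legal_strategy Maker Breaker br'"
    and "p = breaker_win_prob M N Breaker mk br"
    and "pbar = breaker_win_prob M N Maker mk' br'"
  shows "p\<^sup>2 = pgf xi p
    \<and> (pmf xi 1 = 0 \<longrightarrow> p = 0)
    \<and> (pmf_mean xi \<le> 2 \<and> pmf xi 1 > 0 \<longrightarrow> p = 1)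
    \<and> (pmf_mean xi > 2 \<and> pmf xi 1 > 0 \<longrightarrow>
         0 < p \<and> p < 1 \<and> (\<forall>x. 0 < x \<and> x < 1 \<and> x\<^sup>2 = pgf xi x \<longrightarrow> x = p))
    \<and> pbar = pgf xi p \<and> pgf xi p = p\<^sup>2"
proof -
  have gw: "galton_watson_game st mk br M xi N"
    if "legal_strategy st Maker mk" "legal_strategy st Breaker br" for st mk br
    using assms(1) that
    unfolding galton_watson_game_def galton_watson_game_axioms_def maker_breaker_game_def
      galton_watson_def by auto
  have p: "p = eventual_absorption_prob xi 1"
    using galton_watson_game.breaker_win_prob_eq[OF gw[OF assms(3,4)] assms(2)] assms(7) by simp
  have "pbar = eventual_absorption_prob xi 2"
    using galton_watson_game.breaker_win_prob_eq[OF gw[OF assms(5,6)] assms(2)] assms(8) by simp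
  then have "pbar = p\<^sup>2"
    using eventual_absorption_prob_eq_power[OF assms(2), of 2] p by simp
  with eventual_absorption_prob_cases[OF assms(2) p] show ?thesis by metis
qed

end
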